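(* For all integers $k\ge 1$ and $m\ge 0$, we have $w_{2k+1,k,m}=\binom{2k+1}{k-1}N_{k,m}$.
   Context: A Dyck path of semilength $n$ is a word in the letters $U,D$ with $n$ copies of each letter such that no prefix contains more $D$'s than $U$'s. A $UD$-factor (resp. $UUD$-factor) is an occurrence of $UD$ (resp. $UUD$) as a consecutive subword. $w_{n,k,m}$ denotes the number of Dyck paths of semilength $n$ with exactly $k$ $UD$-factors and exactly $m$ $UUD$-factors. The Narayana numbers are $N_{n,j}=\frac{1}{n}\binom{n}{j}\binom{n}{j-1}$ for $n\ge1$ and $j\ge 0$ (so $N_{n,j}=0$ unless $1\le j\le n$), and $N_{0,0}=1$, $N_{0,j}=0$ for $j\ge1$; equivalently $N_{n,j}$ is the number of Dyck paths of semilength $n$ with $j$ $UD$-factors. *)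

theory Defs
  imports Complex_Main "HOL-Library.Sublist"
begin

datatype step = U | D

definition dyck_paths :: "nat \<Rightarrow> step list set" where
  "dyck_paths n = {w. count_list w U = n \<and> count_list w D = n \<and>
     (\<forall>p. prefix p w \<longrightarrow> count_list p D \<le> count_list p U)}"

text \<open>An occurrence of \<open>u\<close> as a consecutive subword of \<open>w\<close> is a factorization \<open>w = p @ u @ s\<close>.\<close>

definition factor_count :: "'a list \<Rightarrow> 'a list \<Rightarrow> nat" where
  "factor_count u w = card {(p, s). w = p @ u @ s}"

definition dyck_count :: "nat \<Rightarrow> nat \<Rightarrow> nat \<Rightarrow> nat" where
  "dyck_count n k m = card {w \<in> dyck_paths n.
     factor_count [U, D] w = k \<and> factor_count [U, U, D] w = m}"

text \<open>The case \<open>j = 0\<close> is separate because \<open>j - 1\<close> truncates on \<^typ>\<open>nat\<close>: the intended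
  value of the binomial coefficient with lower index \<open>-1\<close> is \<open>0\<close>, not \<open>n choose 0 = 1\<close>.\<close>

definition narayana :: "nat \<Rightarrow> nat \<Rightarrow> rat" where
  "narayana n j =
     (if n = 0 then (if j = 0 then 1 else 0)
      else if j = 0 then 0
      else 1 / of_nat n * of_nat (n choose j) * of_nat (n choose (j - 1)))"

end

(* Append one down step to a Dyck path. The resulting word starts with U, ends with D and has
   total height -1; it is determined by the k lengths of its up runs (sum n) and of its down
   runs (sum n + 1), and UUD counts the up runs of length at least 2. By the cycle lemma, of the
   k rotations of such a sequence of (up run, down run) blocks exactly one stems from a Dyck path.
   Hence k * w(n,k,m) is the number of all pairs of compositions,
   binom(n, k-1) * binom(k, m) * binom(n-k-1, m-1), and n = 2k+1 gives the Narayana number. *)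

theory Submission
  imports Defs
begin

subsection \<open>The cycle lemma\<close>

text \<open>Heights are tested before each entry, never after the last one, so a sequence of total
  -1 can still pass from \<open>h = 0\<close>.\<close>

fun nonneg_before :: "int \<Rightarrow> int list \<Rightarrow> bool" where
  "nonneg_before h [] \<longleftrightarrow> True"
| "nonneg_before h (c # cs) \<longleftrightarrow> 0 \<le> h \<and> nonneg_before (h + c) cs"

lemma nonneg_before_iff:
  "nonneg_before h cs \<longleftrightarrow> (\<forall>j<length cs. 0 \<le> h + sum_list (take j cs))"
  by (induction cs arbitrary: h) (auto simp: All_less_Suc2 add.assoc)

text \<open>A prefix of the rotated list either stays inside \<open>drop j cs\<close> or wraps
  around, in which case it has collected the whole total once.\<close>

lemma sum_take_rotate:
  fixes cs :: "int list"
  assumes "j < length cs" "i < length cs"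
  shows "sum_list (take i (rotate j cs)) =
    (if i + j < length cs then sum_list (take (i + j) cs)
     else sum_list cs + sum_list (take (i + j - length cs) cs)) - sum_list (take j cs)"
proof -
  have split: "sum_list cs = sum_list (take j cs) + sum_list (drop j cs)"
    by (metis append_take_drop_id sum_list_append)
  have rot: "rotate j cs = drop j cs @ take j cs"
    using assms(1) by (simp add: rotate_drop_take)
  show ?thesis
  proof (cases "i + j < length cs")
    case True
    have "take (j + i) cs = take j cs @ take i (drop j cs)"
      by (rule take_add)
    then show ?thesis using True by (simp add: rot add.commute)
  next
    case False
    then have "min (i - (length cs - j)) j = i + j - length cs"
      using assms by auto
    then show ?thesis using False assms split by (simp add: rot min.commute)
  qed
qed

text \<open>The good rotations are those starting at the leftmost minimum of the partial sums:
  positions from \<open>j\<close> on are met before wrapping, which gives the weak inequality, and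
  earlier ones after losing the total -1, which makes it strict.\<close>

lemma nonneg_before_rotate_iff:
  assumes "sum_list cs = -1" "j < length cs"
  shows "nonneg_before 0 (rotate j cs) \<longleftrightarrow>
    (\<forall>i<length cs. sum_list (take j cs) \<le> sum_list (take i cs) \<and>
       (i < j \<longrightarrow> sum_list (take j cs) < sum_list (take i cs)))" (is "_ \<longleftrightarrow> ?R")
proof
  assume L: "nonneg_before 0 (rotate j cs)"
  have *: "0 \<le> sum_list (take i (rotate j cs))" if "i < length cs" for i
    using L that by (auto simp: nonneg_before_iff)
  show ?R
  proof (intro allI impI)
    fix i assume i: "i < length cs"
    show "sum_list (take j cs) \<le> sum_list (take i cs) \<and>
       (i < j \<longrightarrow> sum_list (take j cs) < sum_list (take i cs))"
    proof (cases "i < j")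
      case True
      \<comment> \<open>After wrapping around, the rotated list reaches the original position
        \<open>i\<close> at this index.\<close>
      have "i + length cs - j < length cs" using True assms by simp
      from *[OF this] sum_take_rotate[OF assms(2) this] show ?thesis
        using True assms by simp
    next
      case False
      have "i - j < length cs" using i by simp
      from *[OF this] sum_take_rotate[OF assms(2) this] show ?thesis
        using False assms i by simp
    qed
  qed
next
  assume R: ?R
  have "0 \<le> sum_list (take i (rotate j cs))" if i: "i < length cs" for i
  proof (cases "i + j < length cs")
    case True
    then show ?thesis using R sum_take_rotate[OF assms(2) i] by simp
  next
    case False
    then have "i + j - length cs < j" "i + j - length cs < length cs"
      using i assms by auto
    then have "sum_list (take j cs) < sum_list (take (i + j - length cs) cs)"
      using R by blast
    then show ?thesis using False sum_take_rotate[OF assms(2) i] assms by simp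
  qed
  then show "nonneg_before 0 (rotate j cs)"
    by (auto simp: nonneg_before_iff)
qed

text \<open>A finite nonempty list of partial sums has exactly one leftmost minimum, found here with
  \<open>LEAST\<close>.\<close>

lemma cycle_lemma:
  assumes "sum_list cs = -1"
  shows "\<exists>!j. j < length cs \<and> nonneg_before 0 (rotate j cs)"
proof -
  define S where "S i = sum_list (take i cs)" for i
  define P where "P j \<longleftrightarrow> j < length cs \<and> S j = Min (S ` {..<length cs})" for j
  have ne: "cs \<noteq> []" using assms by auto
  have "Min (S ` {..<length cs}) \<in> S ` {..<length cs}"
    using ne by (intro Min_in) auto
  then have "\<exists>j. P j" by (auto simp: P_def)
  then have LP: "P (LEAST j. P j)" by (rule LeastI_ex)
  define l where "l = (LEAST j. P j)"
  have l: "l < length cs" and lmin: "\<And>i. i < length cs \<Longrightarrow> S l \<le> S i"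
    using LP by (auto simp: P_def l_def)
  have lless: "S l < S i" if "i < l" for i
  proof -
    have "i < length cs" using that l by simp
    moreover have "\<not> P i" using that unfolding l_def by (rule not_less_Least)
    ultimately have "S i \<noteq> S l" using LP by (auto simp: P_def l_def)
    then show ?thesis using lmin[OF \<open>i < length cs\<close>] by simp
  qed
  show ?thesis
  proof (rule ex1I[of _ l])
    show "l < length cs \<and> nonneg_before 0 (rotate l cs)"
      using l lmin lless nonneg_before_rotate_iff[OF assms l] by (auto simp: S_def)
  next
    fix j assume j: "j < length cs \<and> nonneg_before 0 (rotate j cs)"
    then have "S j \<le> S i \<and> (i < j \<longrightarrow> S j < S i)" if "i < length cs" for i
      using nonneg_before_rotate_iff[OF assms, of j] that by (auto simp: S_def)
    then show "j = l" using l lmin lless j by (metis linorder_neqE_nat not_less)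
  qed
qed

subsection \<open>Dyck paths as lists of blocks\<close>

text \<open>The pair \<open>(a, b)\<close> encodes the block of \<open>Suc a\<close> up steps and \<open>Suc b\<close> down steps, so that
  every list of pairs is admissible.\<close>

fun blocks_path :: "(nat \<times> nat) list \<Rightarrow> step list" where
  "blocks_path [] = []"
| "blocks_path ((a, b) # xs) = replicate (Suc a) U @ replicate (Suc b) D @ blocks_path xs"

definition step_height :: "step \<Rightarrow> int" where
  "step_height x = (case x of U \<Rightarrow> 1 | D \<Rightarrow> -1)"

definition block_height :: "nat \<times> nat \<Rightarrow> int" where
  "block_height x = int (fst x) - int (snd x)"

lemma step_height_simps [simp]: "step_height U = 1" "step_height D = -1"
  by (simp_all add: step_height_def)

lemma sum_list_step_height:
  "sum_list (map step_height w) = int (count_list w U) - int (count_list w D)"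
proof (induction w)
  case (Cons x w)
  then show ?case by (cases x) auto
qed simp

lemma sum_list_block_height:
  "sum_list (map block_height xs) =
     int (sum_list (map fst xs)) - int (sum_list (map snd xs))"
  by (induction xs) (auto simp: block_height_def)

section \<open>Letters and factors in block words\<close>

lemma count_list_replicate: "count_list (replicate n x) y = (if x = y then n else 0)"
  by (induction n) auto

lemma count_list_blocks_path:
  "count_list (blocks_path xs) U = sum_list (map fst xs) + length xs"
  "count_list (blocks_path xs) D = sum_list (map snd xs) + length xs"
  by (induction xs rule: blocks_path.induct) (auto simp: count_list_replicate)

text \<open>Occurrences in \<open>w\<close> are shifted by consing \<open>x\<close> onto the left
  part; the only other one can start at the front. This recursion replaces the cardinality in all
  later counts.\<close>

lemma factor_count_Cons:
  fixes u w :: "'a list"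
  assumes "u \<noteq> []"
  shows "factor_count u (x # w) = factor_count u w + (if prefix u (x # w) then 1 else 0)"
proof -
  let ?A = "{(p, s). w = p @ u @ s}"
  let ?f = "\<lambda>(p, s). (x # p, s)"
  let ?B = "{(p :: 'a list, s). p = [] \<and> x # w = u @ s}"
  \<comment> \<open>Finiteness must be shown for \<open>card\<close> to be additive on the union
    below.\<close>
  have "finite (set (prefixes w) \<times> set (suffixes w))" by simp
  moreover have "?A \<subseteq> set (prefixes w) \<times> set (suffixes w)"
    by (auto simp: suffix_def)
  ultimately have finA: "finite ?A" by (rule finite_subset[rotated])
  have B: "?B = (if prefix u (x # w) then {([], drop (length u) (x # w))} else {})"
    by (auto simp: prefix_def)
  have "{(p, s). x # w = p @ u @ s} = ?f ` ?A \<union> ?B"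
    by (force simp: Cons_eq_append_conv image_iff)
  moreover have "?f ` ?A \<inter> ?B = {}" by auto
  moreover have "finite ?B" by (subst B) simp
  moreover have "card (?f ` ?A) = card ?A"
    by (rule card_image) (auto simp: inj_on_def)
  moreover have "finite (?f ` ?A)" using finA by (rule finite_imageI)
  ultimately have "card {(p, s). x # w = p @ u @ s} = card ?A + card ?B"
    by (simp only: card_Un_disjoint)
  then show ?thesis unfolding factor_count_def by (subst (asm) B) simp
qed

lemma factor_count_Nil: "u \<noteq> [] \<Longrightarrow> factor_count u [] = 0"
  by (simp add: factor_count_def)

lemma factor_count_replicate_D:
  "factor_count (U # u) (replicate b D @ w) = factor_count (U # u) w"
  by (induction b) (auto simp: factor_count_Cons)

lemma factor_count_UD_replicate_U:
  "factor_count [U, D] (replicate (Suc a) U @ D # w) = Suc (factor_count [U, D] w)"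
  by (induction a) (auto simp: factor_count_Cons)

text \<open>Only the end of an up run can carry UUD, and the run of length \<open>Suc a\<close> must
  have length at least 2.\<close>

lemma factor_count_UUD_replicate_U:
  "factor_count [U, U, D] (replicate (Suc a) U @ D # w) =
     factor_count [U, U, D] w + (if a \<noteq> 0 then 1 else 0)"
proof (induction a)
  case (Suc a)
  then show ?case by (cases a) (auto simp: factor_count_Cons)
qed (auto simp: factor_count_Cons)

lemma factor_count_blocks_path:
  "factor_count [U, D] (blocks_path xs) = length xs"
  "factor_count [U, U, D] (blocks_path xs) = length (filter (\<lambda>a. a \<noteq> 0) (map fst xs))"
  using factor_count_UD_replicate_U factor_count_UUD_replicate_U
  by (induction xs rule: blocks_path.induct)
     (simp_all add: factor_count_Nil factor_count_replicate_D del: replicate_Suc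
       add: replicate_Suc[of _ D])

text \<open>Neither factor ends in DD, so a D after a final D creates none. Hence the extra down
  step leaves both statistics of a Dyck path unchanged.\<close>

lemma factor_count_append_D:
  "factor_count [U, D] (v @ [D, D]) = factor_count [U, D] (v @ [D])"
  "factor_count [U, U, D] (v @ [D, D]) = factor_count [U, U, D] (v @ [D])"
proof (induction v)
  case (Cons x v)
  have "prefix [U, D] (x # v @ [D, D]) = prefix [U, D] (x # v @ [D])"
    "prefix [U, U, D] (x # v @ [D, D]) = prefix [U, U, D] (x # v @ [D])"
    by (cases v; cases "tl v"; auto)+
  with Cons show "factor_count [U, D] ((x # v) @ [D, D]) = factor_count [U, D] ((x # v) @ [D])"
    "factor_count [U, U, D] ((x # v) @ [D, D]) = factor_count [U, U, D] ((x # v) @ [D])"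
    by (simp_all add: factor_count_Cons)
qed (simp_all add: factor_count_Cons factor_count_Nil)

section \<open>Heights along runs and blocks\<close>

lemma nonneg_before_replicate_U:
  "nonneg_before h (map step_height (replicate (Suc a) U @ w)) \<longleftrightarrow>
     0 \<le> h \<and> nonneg_before (h + int (Suc a)) (map step_height w)"
proof (induction a arbitrary: h)
  case (Suc a)
  have "h + 1 + int (Suc a) = h + int (Suc (Suc a))" by simp
  with Suc[of "h + 1"] show ?case by (auto simp del: of_nat_Suc)
qed simp

text \<open>The bound is \<open>b\<close> and not \<open>Suc b\<close>, since the height after the
  last of the down steps is tested only if \<open>w\<close> continues.\<close>

lemma nonneg_before_replicate_D:
  "nonneg_before h (map step_height (replicate (Suc b) D @ w)) \<longleftrightarrow>
     int b \<le> h \<and> nonneg_before (h - int (Suc b)) (map step_height w)"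
proof (induction b arbitrary: h)
  case (Suc b)
  have "h - 1 - int (Suc b) = h - int (Suc (Suc b))" by simp
  with Suc[of "h - 1"] show ?case by (auto simp del: of_nat_Suc)
qed simp

text \<open>The height is minimal at the block ends, except that the very last block may end
  at height \<open>-1\<close>.\<close>

lemma nonneg_before_blocks_path:
  assumes "h + sum_list (map block_height xs) = -1"
  shows "nonneg_before h (map step_height (blocks_path xs)) \<longleftrightarrow>
    nonneg_before h (map block_height xs)"
  using assms
proof (induction xs arbitrary: h rule: blocks_path.induct)
  case (2 a b xs)
  have IH: "nonneg_before (h + block_height (a, b)) (map step_height (blocks_path xs)) =
      nonneg_before (h + block_height (a, b)) (map block_height xs)"
    by (rule "2.IH") (use "2.prems" in simp)
  have "nonneg_before h (map step_height (blocks_path ((a, b) # xs))) \<longleftrightarrow>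
     0 \<le> h \<and> 0 \<le> h + block_height (a, b) + 1 \<and>
     nonneg_before (h + block_height (a, b)) (map step_height (blocks_path xs))"
    unfolding blocks_path.simps nonneg_before_replicate_U nonneg_before_replicate_D
    by (auto simp: block_height_def algebra_simps)
  \<comment> \<open>The middle condition is redundant: a further block requires the stronger bound
    0, and at the end the height is -1 by assumption.\<close>
  also have "\<dots> \<longleftrightarrow> 0 \<le> h \<and> nonneg_before (h + block_height (a, b)) (map block_height xs)"
    unfolding IH using "2.prems" by (cases xs) auto
  finally show ?case by simp
qed simp

section \<open>Existence and uniqueness of the block decomposition\<close>

lemma blocks_path_eq_Nil_iff [simp]: "blocks_path xs = [] \<longleftrightarrow> xs = []"
  by (cases xs rule: blocks_path.cases) auto

lemma blocks_path_cases: "blocks_path xs = [] \<or> (\<exists>w. blocks_path xs = U # w)"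
  by (cases xs rule: blocks_path.cases) auto

lemma last_blocks_path: "xs \<noteq> [] \<Longrightarrow> last (blocks_path xs) = D"
  by (induction xs rule: blocks_path.induct) (auto simp: last_append)

lemma replicate_append_eq_iff:
  assumes "w = [] \<or> hd w \<noteq> x" "w' = [] \<or> hd w' \<noteq> x"
  shows "replicate m x @ w = replicate n x @ w' \<longleftrightarrow> m = n \<and> w = w'"
proof (induction m arbitrary: n)
  case 0
  then show ?case using assms by (cases n) auto
next
  case (Suc m)
  then show ?case using assms by (cases n) auto
qed

text \<open>The runs in a block word are maximal, so their lengths can be read off one after
  another.\<close>

lemma inj_blocks_path: "inj blocks_path"
proof
  fix xs ys
  show "blocks_path xs = blocks_path ys \<Longrightarrow> xs = ys"
  proof (induction xs arbitrary: ys rule: blocks_path.induct)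
    case 1
    then show ?case by (metis blocks_path_eq_Nil_iff)
  next
    case (2 a b xs)
    then obtain c d zs where ys: "ys = (c, d) # zs"
      by (cases ys rule: blocks_path.cases) auto
    have neD: "blocks_path zs = [] \<or> hd (blocks_path zs) \<noteq> D" for zs
      using blocks_path_cases[of zs] by auto
    have "replicate (Suc a) U @ (replicate (Suc b) D @ blocks_path xs) =
        replicate (Suc c) U @ (replicate (Suc d) D @ blocks_path zs)"
      using 2(2) ys by simp
    then have "a = c" "replicate (Suc b) D @ blocks_path xs = replicate (Suc d) D @ blocks_path zs"
      by (subst (asm) replicate_append_eq_iff; simp)+
    with replicate_append_eq_iff[OF neD neD] have "b = d" "blocks_path xs = blocks_path zs"
      by blast+
    then show ?case using \<open>a = c\<close> 2(1) ys by simp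
  qed
qed

text \<open>The induction adds letters in front, so an unfinished leading up run, possibly empty, is
  allowed; a D in front of a nonempty one closes off a block.\<close>

lemma obtain_blocks:
  "\<exists>a b xs. v @ [D] = replicate a U @ replicate (Suc b) D @ blocks_path xs"
proof (induction v)
  case Nil
  have "[] @ [D] = replicate 0 U @ replicate (Suc 0) D @ blocks_path []" by simp
  then show ?case by blast
next
  case (Cons x v)
  then obtain a b xs where v: "v @ [D] = replicate a U @ replicate (Suc b) D @ blocks_path xs"
    by blast
  show ?case
  proof (cases x)
    case U
    then have "(x # v) @ [D] = replicate (Suc a) U @ replicate (Suc b) D @ blocks_path xs"
      using v by simp
    then show ?thesis by blast
  next
    case D
    show ?thesis
    proof (cases a)
      case 0
      then have "(x # v) @ [D] = replicate 0 U @ replicate (Suc (Suc b)) D @ blocks_path xs"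
        using v D by simp
      then show ?thesis by blast
    next
      case (Suc c)
      then have "(x # v) @ [D] = replicate 0 U @ replicate (Suc 0) D @ blocks_path ((c, b) # xs)"
        using v D by simp
      then show ?thesis by blast
    qed
  qed
qed

lemma blocks_path_surj:
  assumes "hd (v @ [D]) = U"
  shows "\<exists>xs. v @ [D] = blocks_path xs"
proof -
  obtain a b xs where v: "v @ [D] = replicate a U @ replicate (Suc b) D @ blocks_path xs"
    using obtain_blocks by blast
  with assms obtain c where "a = Suc c" by (cases a) auto
  with v have "v @ [D] = blocks_path ((c, b) # xs)" by simp
  then show ?thesis by blast
qed

subsection \<open>Counting\<close>

text \<open>The proper prefixes of \<open>v @ [D]\<close> are exactly the prefixes of
  \<open>v\<close>, so \<open>nonneg_before\<close> on the extended word expresses the Dyck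
  condition.\<close>

lemma dyck_paths_iff:
  "v \<in> dyck_paths n \<longleftrightarrow> count_list v U = n \<and> count_list v D = n \<and>
     nonneg_before 0 (map step_height (v @ [D]))"
proof -
  have "(\<forall>p. prefix p v \<longrightarrow> count_list p D \<le> count_list p U) \<longleftrightarrow>
     (\<forall>j\<le>length v. 0 \<le> sum_list (map step_height (take j v)))"
    unfolding sum_list_step_height
    by (auto simp: take_is_prefix) (metis append_eq_conv_conj prefix_def prefix_length_le)
  moreover have "\<dots> \<longleftrightarrow> nonneg_before 0 (map step_height (v @ [D]))"
    by (auto simp: nonneg_before_iff take_map less_Suc_eq_le)
  ultimately show ?thesis by (auto simp: dyck_paths_def)
qed

lemma dyck_paths_last:
  assumes "v \<in> dyck_paths n" "n \<ge> 1"
  shows "\<exists>u. v = u @ [D]"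
proof (cases v rule: rev_cases)
  case Nil
  then show ?thesis using assms by (auto simp: dyck_paths_def)
next
  case (snoc u x)
  have "prefix u v" using snoc by simp
  then have "count_list u D \<le> count_list u U"
    using assms by (auto simp: dyck_paths_def)
  then show ?thesis using assms snoc by (cases x) (auto simp: dyck_paths_def)
qed

lemma dyck_paths_hd:
  assumes "v \<in> dyck_paths n" "n \<ge> 1"
  shows "hd (v @ [D]) = U"
proof (cases v)
  case Nil
  then show ?thesis using assms by (auto simp: dyck_paths_def)
next
  case (Cons x u)
  have "prefix [x] v" using Cons by simp
  then have "count_list [x] D \<le> count_list [x] U"
    using assms(1) unfolding dyck_paths_def by blast
  then show ?thesis using Cons by (cases x) auto
qed

text \<open>The codes of the extended words with the nonnegativity condition dropped. Adding
  \<open>k\<close> undoes the shift by one in each run; the down total is \<open>Suc n\<close>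
  because of the appended step.\<close>

definition block_lists :: "nat \<Rightarrow> nat \<Rightarrow> nat \<Rightarrow> (nat \<times> nat) list set" where
  "block_lists n k m = {xs. length xs = k \<and>
     sum_list (map fst xs) + k = n \<and> sum_list (map snd xs) + k = Suc n \<and>
     length (filter (\<lambda>a. a \<noteq> 0) (map fst xs)) = m}"

lemma sum_block_height_block_lists:
  "xs \<in> block_lists n k m \<Longrightarrow> sum_list (map block_height xs) = -1"
  by (auto simp: sum_list_block_height block_lists_def)

text \<open>The injections \<open>v \<mapsto> v @ [D]\<close> and \<open>blocks_path\<close> have
  the same image on the two sets.\<close>

lemma dyck_count_eq_card_block_lists:
  assumes "n \<ge> 1"
  shows "dyck_count n k m =
    card {xs \<in> block_lists n k m. nonneg_before 0 (map block_height xs)}"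
proof -
  let ?W = "{w \<in> dyck_paths n. factor_count [U, D] w = k \<and> factor_count [U, U, D] w = m}"
  let ?X = "{xs \<in> block_lists n k m. nonneg_before 0 (map block_height xs)}"
  let ?f = "\<lambda>v. v @ [D]"
  have fc: "factor_count [U, D] (v @ [D]) = factor_count [U, D] v"
    "factor_count [U, U, D] (v @ [D]) = factor_count [U, U, D] v"
    if v: "v \<in> dyck_paths n" for v
    using dyck_paths_last[OF v assms] factor_count_append_D by auto
  have "?f ` ?W = blocks_path ` ?X"
  proof (intro equalityI subsetI)
    fix w assume "w \<in> ?f ` ?W"
    then obtain v where w: "w = v @ [D]" and v: "v \<in> ?W" by blast
    then obtain xs where xs: "v @ [D] = blocks_path xs"
      using blocks_path_surj dyck_paths_hd assms by blast
    have "xs \<in> block_lists n k m"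
      using v fc[of v] count_list_blocks_path[of xs] factor_count_blocks_path[of xs]
      unfolding xs[symmetric] by (auto simp: block_lists_def dyck_paths_iff)
    moreover have "nonneg_before 0 (map block_height xs)"
      using nonneg_before_blocks_path[of 0 xs] sum_block_height_block_lists[OF calculation] v
      unfolding xs[symmetric] by (simp add: dyck_paths_iff)
    ultimately show "w \<in> blocks_path ` ?X" using w xs by blast
  next
    fix w assume "w \<in> blocks_path ` ?X"
    then obtain xs where w: "w = blocks_path xs" and xs: "xs \<in> ?X" by blast
    have "xs \<noteq> []" using xs assms by (auto simp: block_lists_def)
    then have vw: "w = butlast w @ [D]"
      using last_blocks_path[of xs] w append_butlast_last_id[of w] by simp
    define v where "v = butlast w"
    have v: "blocks_path xs = v @ [D]" using vw w by (simp add: v_def)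
    have "nonneg_before 0 (map step_height (v @ [D]))"
      using nonneg_before_blocks_path[of 0 xs] xs sum_block_height_block_lists
      by (auto simp flip: v)
    then have dyck: "v \<in> dyck_paths n"
      using xs count_list_blocks_path[of xs] unfolding v
      by (auto simp: dyck_paths_iff block_lists_def)
    then have "v \<in> ?W"
      using fc[OF dyck] xs factor_count_blocks_path[of xs] unfolding v
      by (auto simp: block_lists_def)
    then show "w \<in> ?f ` ?W" using v w by blast
  qed
  moreover have "card (?f ` ?W) = card ?W"
    by (rule card_image) (auto simp: inj_on_def)
  moreover have "card (blocks_path ` ?X) = card ?X"
    by (rule card_image) (rule inj_on_subset[OF inj_blocks_path], simp)
  ultimately show ?thesis by (simp add: dyck_count_def)
qed

lemma finite_length_sum_list: "finite {l :: nat list. length l = k \<and> sum_list l = s}"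
proof (rule finite_subset)
  show "{l. length l = k \<and> sum_list l = s} \<subseteq> {l. set l \<subseteq> {..s} \<and> length l = k}"
    using member_le_sum_list by fastforce
qed (simp add: finite_lists_length_eq)

lemma block_lists_rotate: "rotate j xs \<in> block_lists n k m \<longleftrightarrow> xs \<in> block_lists n k m"
proof -
  have "sum_list (map f (rotate j xs)) = sum_list (map f xs)"
    "length (filter P (map f (rotate j xs))) = length (filter P (map f xs))"
    for f :: "nat \<times> nat \<Rightarrow> nat" and P
  proof -
    have "sum_list (map f (rotate1 ys)) = sum_list (map f ys)"
      "length (filter P (map f (rotate1 ys))) = length (filter P (map f ys))" for ys
      by (cases ys; simp)+
    then show "sum_list (map f (rotate j xs)) = sum_list (map f xs)"
      "length (filter P (map f (rotate j xs))) = length (filter P (map f xs))"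
      by (induction j) (simp_all add: rotate_def del: filter_map length_filter_map)
  qed
  then show ?thesis by (simp add: block_lists_def)
qed

text \<open>By the cycle lemma the sets \<open>?B j\<close> with \<open>j < k\<close> partition the
  block lists, and rotation by \<open>j\<close> maps each of them bijectively onto the nonnegative
  ones.\<close>

lemma card_block_lists_eq_mult:
  assumes "n \<ge> 1" "finite (block_lists n k m)"
  shows "card (block_lists n k m) = k * dyck_count n k m"
proof -
  let ?A = "block_lists n k m"
  let ?G = "\<lambda>xs. nonneg_before 0 (map block_height xs)"
  let ?B = "\<lambda>j. {xs \<in> ?A. ?G (rotate j xs)}"
  have ex1: "\<exists>!j. j < k \<and> ?G (rotate j xs)" if "xs \<in> ?A" for xs
    using cycle_lemma[OF sum_block_height_block_lists[OF that]] that
    by (simp add: rotate_map block_lists_def)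
  have "?A = (\<Union>j\<in>{..<k}. ?B j)" using ex1 by blast
  moreover have "card (\<Union>j\<in>{..<k}. ?B j) = (\<Sum>j<k. card (?B j))"
    by (rule card_UN_disjoint) (use assms(2) ex1 in auto)
  moreover have "card (?B j) = card {xs \<in> ?A. ?G xs}" for j
  proof -
    have bij: "bij (rotate j :: (nat \<times> nat) list \<Rightarrow> _)"
      unfolding rotate_def by (intro bij_fn bij_rotate1)
    have "rotate j ` ?B j = {xs \<in> ?A. ?G xs}"
    proof (intro equalityI subsetI)
      fix ys assume ys: "ys \<in> {xs \<in> ?A. ?G xs}"
      obtain xs where "ys = rotate j xs" using bij by (rule bij_pointE) blast
      then show "ys \<in> rotate j ` ?B j" using ys by (auto simp: block_lists_rotate)
    qed (auto simp: block_lists_rotate)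
    moreover have "card (rotate j ` ?B j) = card (?B j)"
      using bij by (intro card_image) (metis bij_is_inj inj_on_subset subset_UNIV)
    ultimately show ?thesis by simp
  qed
  ultimately show ?thesis by (simp add: dyck_count_eq_card_block_lists[OF assms(1)])
qed

section \<open>Counting compositions and lists with prescribed nonzero entries\<close>

lemma card_lists_filter_neq:
  assumes "z \<notin> set ys"
  shows "card {l. length l = k \<and> filter (\<lambda>x. x \<noteq> z) l = ys} = k choose length ys"
    and "finite {l. length l = k \<and> filter (\<lambda>x. x \<noteq> z) l = ys}"
proof -
  define F where "F k ys = {l. length l = k \<and> filter (\<lambda>x. x \<noteq> z) l = ys}" for k and ys :: "'a list"
  have "card (F k ys) = k choose length ys \<and> finite (F k ys)"
    using assms
  proof (induction k arbitrary: ys)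
    case 0
    have "F 0 ys = (if ys = [] then {[]} else {})" by (auto simp: F_def)
    then show ?case by (cases ys) auto
  next
    case (Suc k)
    have inj: "card (Cons x ` S) = card S" for x :: 'a and S
      by (rule card_image) simp
    show ?case
    proof (cases ys)
      case Nil
      then have "F (Suc k) ys = Cons z ` F k ys"
        by (auto simp: F_def length_Suc_conv image_iff split: if_splits)
      then show ?thesis using Suc Nil inj by simp
    next
      case (Cons y zs)
      \<comment> \<open>Pascal's recursion: the list starts with the filler \<open>z\<close> or with
        the first kept entry \<open>y\<close>.\<close>
      then have "F (Suc k) ys = Cons z ` F k ys \<union> Cons y ` F k zs"
        using Suc.prems by (auto simp: F_def length_Suc_conv image_iff split: if_splits)
      moreover have "Cons z ` F k ys \<inter> Cons y ` F k zs = {}"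
        using Suc.prems Cons by auto
      ultimately show ?thesis
        using Suc.IH[of ys] Suc.IH[of zs] Suc.prems Cons inj by (simp add: card_Un_disjoint)
    qed
  qed
  then show "card {l. length l = k \<and> filter (\<lambda>x. x \<noteq> z) l = ys} = k choose length ys"
    "finite {l. length l = k \<and> filter (\<lambda>x. x \<noteq> z) l = ys}"
    by (simp_all add: F_def)
qed

text \<open>Lowering every part by 1 leaves weak compositions of \<open>Suc s - m\<close>, counted
  by stars and bars.\<close>

lemma card_compositions:
  assumes "m \<ge> 1"
  shows "card {l :: nat list. length l = m \<and> 0 \<notin> set l \<and> sum_list l = Suc s} = s choose (m - 1)"
    (is "card ?C = _")
proof -
  have sum_Suc: "sum_list (map Suc l) = sum_list l + length l" for l
    by (induction l) auto
  have pos: "l = map Suc (map (\<lambda>x. x - 1) l)" if "0 \<notin> set l" for l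
    using that by (induction l) auto
  let ?L = "{l. length l = m \<and> sum_list l + m = Suc s}"
  have "?C = map Suc ` ?L"
  proof (intro equalityI subsetI)
    fix l assume l: "l \<in> ?C"
    define l' where "l' = map (\<lambda>x. x - 1) l"
    have "l = map Suc l'" using l pos unfolding l'_def by blast
    moreover from this have "l' \<in> ?L" using l by (auto simp: sum_Suc)
    ultimately show "l \<in> map Suc ` ?L" by blast
  qed (auto simp: sum_Suc)
  then have card: "card ?C = card ?L" by (simp only:) (intro card_image inj_onI; simp)
  show ?thesis
  \<comment> \<open>The subtraction \<open>Suc s - m\<close> is faithful only in the first case; in
    the second both sides are 0.\<close>
  proof (cases "m \<le> Suc s")
    case True
    then have "?L = {l. length l = m \<and> sum_list l = Suc s - m}" by auto
    then have "card ?L = (Suc s - m + m - 1) choose (Suc s - m)"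
      by (simp only: card_length_sum_list)
    also have "\<dots> = s choose (s - (m - 1))" using True assms by simp
    also have "\<dots> = s choose (m - 1)" using True by (simp flip: binomial_symmetric)
    finally show ?thesis using card by simp
  next
    case False
    then have "?L = {}" by auto
    then show ?thesis using card False by simp
  qed
qed

text \<open>Lists are grouped by their nonzero entries in order, a composition of
  \<open>Suc s\<close> into \<open>m\<close> parts, whose positions can be chosen in
  \<open>k choose m\<close> ways. For \<open>m = 0\<close> there is no such composition, while
  \<open>m - 1\<close> would truncate.\<close>

lemma card_lists_sum_nonzeros:
  "card {l :: nat list. length l = k \<and> sum_list l = Suc s \<and>
      length (filter (\<lambda>x. x \<noteq> 0) l) = m} =
    (if m = 0 then 0 else (k choose m) * (s choose (m - 1)))"
    (is "card ?S = _")
proof -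
  let ?C = "{l :: nat list. length l = m \<and> 0 \<notin> set l \<and> sum_list l = Suc s}"
  let ?F = "\<lambda>ys. {l. length l = k \<and> filter (\<lambda>x. x \<noteq> 0) l = ys}"
  have sum: "sum_list (filter (\<lambda>x. x \<noteq> 0) l) = sum_list l" for l :: "nat list"
    by (induction l) auto
  have "?S = (\<Union>ys\<in>?C. ?F ys)" using sum by auto
  moreover have "finite ?C"
    by (rule finite_subset[OF _ finite_length_sum_list[of m "Suc s"]]) auto
  ultimately have "card ?S = (\<Sum>ys\<in>?C. card (?F ys))"
    by (simp only:) (rule card_UN_disjoint, use card_lists_filter_neq(2) in \<open>auto simp del: neq0_conv\<close>)
  also have "\<dots> = (\<Sum>ys\<in>?C. k choose m)"
    by (rule sum.cong) (auto simp: card_lists_filter_neq(1) simp del: neq0_conv)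
  also have "\<dots> = card ?C * (k choose m)" by simp
  finally show ?thesis
    using card_compositions[of m s] by (cases "m = 0") auto
qed

text \<open>Up runs and down runs are chosen independently. As \<open>k < n\<close>, the up runs
  have positive total excess over length 1, written as a \<open>Suc\<close> to fit the previous
  count.\<close>

lemma card_block_lists:
  assumes "k \<ge> 1" "k < n"
  shows "card (block_lists n k m) =
      (n choose (k - 1)) * (if m = 0 then 0 else (k choose m) * ((n - k - 1) choose (m - 1)))"
    and "finite (block_lists n k m)"
proof -
  let ?A = "{l :: nat list. length l = k \<and> sum_list l = Suc (n - k - 1) \<and>
      length (filter (\<lambda>x. x \<noteq> 0) l) = m}"
  let ?B = "{l :: nat list. length l = k \<and> sum_list l = Suc n - k}"
  let ?f = "\<lambda>xs. (map fst xs, map snd xs)"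
  have "bij_betw ?f (block_lists n k m) (?A \<times> ?B)"
    by (rule bij_betw_byWitness[where f' = "\<lambda>(a, b). zip a b"])
       (use assms in \<open>auto simp: block_lists_def zip_map_fst_snd
         simp del: filter_map length_filter_map\<close>)
  moreover have "finite ?A"
    by (rule finite_subset[OF _ finite_length_sum_list[of k "Suc (n - k - 1)"]]) auto
  then have "finite (?A \<times> ?B)" using finite_length_sum_list by (rule finite_cartesian_product)
  ultimately show "finite (block_lists n k m)" by (simp add: bij_betw_finite)
  have "card ?B = (Suc n - k + k - 1) choose (Suc n - k)"
    by (rule card_length_sum_list)
  also have "\<dots> = n choose (k - 1)"
    using assms binomial_symmetric[of "k - 1" n] by simp
  finally have B: "card ?B = n choose (k - 1)" .
  have "card (block_lists n k m) = card ?A * card ?B"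
    using \<open>bij_betw ?f _ _\<close> by (simp only: bij_betw_same_card card_cartesian_product)
  then show "card (block_lists n k m) =
      (n choose (k - 1)) * (if m = 0 then 0 else (k choose m) * ((n - k - 1) choose (m - 1)))"
    unfolding B card_lists_sum_nonzeros by simp
qed

theorem theorem1p3:
  fixes k m :: nat
  assumes "k \<ge> 1"
  shows "of_nat (dyck_count (2 * k + 1) k m) =
    of_nat ((2 * k + 1) choose (k - 1)) * narayana k m"
proof -
  let ?n = "2 * k + 1"
  \<comment> \<open>The choice of semilength makes both binomials for the up runs have upper index
    \<open>k\<close>.\<close>
  have lt: "k < ?n" and diff: "?n - k - 1 = k" by simp_all
  have "k * dyck_count ?n k m = card (block_lists ?n k m)"
    using card_block_lists_eq_mult[OF _ card_block_lists(2)[OF assms lt]] by simp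
  also have "\<dots> =
      (?n choose (k - 1)) * (if m = 0 then 0 else (k choose m) * (k choose (m - 1)))"
    using card_block_lists(1)[OF assms lt] unfolding diff .
  finally have "k * dyck_count ?n k m =
      (?n choose (k - 1)) * (if m = 0 then 0 else (k choose m) * (k choose (m - 1)))" .
  from arg_cong[OF this, of "of_nat :: nat \<Rightarrow> rat"]
  have "of_nat k * (of_nat (dyck_count ?n k m) :: rat) =
      of_nat (?n choose (k - 1)) *
      (if m = 0 then 0 else of_nat (k choose m) * of_nat (k choose (m - 1)))"
    by (simp only: of_nat_mult of_nat_0 if_distrib[of of_nat])
  \<comment> \<open>Dividing by \<open>k\<close> supplies the factor \<open>1 / k\<close> of the
    Narayana number.\<close>
  then show ?thesis
    using assms by (auto simp: narayana_def field_simps)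
qed

end
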